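(* For $\theta\in(0,1)$ and $n\in\mathbb N$, $$\Theta(1,1;\theta,2n+1)=(n+2)^{1-\theta}.$$ Moreover, $\Theta(1,1;\theta,2n+1)$ is achieved at $\nu\in\mathcal M^c_{1,1}(S^{2n+1})$ if and only if $$\nu=\frac1{n+2}\sum_{i=1}^{n+2}\delta_{x_i}$$ with $x_1,\dots,x_{n+2}\in S^{2n+1}$ being the vertices of a regular $(n+1)$-simplex embedded in the unit ball.
   Context: $S^{2n+1}\subset\mathbb C^{n+1}=\mathbb R^{2n+2}$ is the unit sphere with the volume measure $d\xi=\theta_0\wedge(d\theta_0)^n$, $\theta_0=\frac i2\sum_j(z^jd\bar z^j-\bar z^jdz^j)$ (a constant multiple of the surface measure). A polynomial $g$ in $z,\bar z$ on $\mathbb C^{n+1}$ is homogeneous of bidegree $(w,w')$ if $g(\lambda z)=\lambda^w\bar\lambda^{w'}g(z)$ for all $\lambda\in\mathbb C$, $z\in\mathbb C^{n+1}$; $\mathcal P_{w,w'}$ is the set of these, $\widetilde{\mathcal P}_{w,w'}=\bigcup_{\tilde w\le w,\ \tilde w'\le w'}\mathcal P_{\tilde w,\tilde w'}$ (nonnegative integers $\tilde w,\tilde w'$), and $\overline{\mathcal P}_{w,w'}=\{g\in\widetilde{\mathcal P}_{w,w'}:\int_{S^{2n+1}}g\,d\xi=0\}$. $\mathcal M^c_{w,w'}(S^{2n+1})$ is the set of probability measures $\nu$ on $S^{2n+1}$ supported on countably many points with $\int g\,d\nu=0$ for all $g\in\overline{\mathcal P}_{w,w'}$, and $$\Theta(w,w';\theta,2n+1)=\inf\Big\{\sum_i\nu_i^\theta:\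 \nu\in\mathcal M^c_{w,w'}(S^{2n+1}),\ \mathrm{supp}(\nu)=\{x_i\},\ \nu_i=\nu(\{x_i\})\Big\}.$$ Here $\theta$ is a real exponent, and "achieved at $\nu$" means $\sum_i\nu_i^\theta=\Theta(1,1;\theta,2n+1)$. *)

theory Defs
  imports "HOL-Probability.Probability"
begin

text \<open>
  The dimension \<open>n + 1\<close> of the ambient space is carried by a finite index type \<open>'d\<close>,
  so that \<open>complex ^ 'd\<close> is $\mathbb{C}^{n+1}$ and \<open>sphere 0 1\<close> in it is $S^{2n+1}$,
  where \<open>n + 1 = CARD('d)\<close>.
\<close>

definition csphere :: "(complex ^ 'd::finite) measure" where
  "csphere = restrict_space borel (sphere 0 1)"

text \<open>
  The volume measure of the form $\theta_0 \wedge (d\theta_0)^n$. In real coordinates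
  $z^j = x^j + i y^j$ one has $\theta_0 = \sum_j (x^j dy^j - y^j dx^j)$ and
  $d\theta_0 = 2 \sum_j dx^j \wedge dy^j$, so $(d\theta_0)^{n+1} = 2^{n+1} (n+1)!\, dV$ with $dV$
  the Lebesgue volume form. For the Euler field $E$, $\iota_E d\theta_0 = 2 \theta_0$, hence
  $\theta_0 \wedge (d\theta_0)^n = \frac{1}{2(n+1)} \iota_E (d\theta_0)^{n+1} = 2^n n!\, \iota_E dV$,
  and $\iota_E dV$ restricts to the surface measure of the unit sphere. The surface measure
  of a Borel set $A$ is $2n + 2$ times the Lebesgue volume of the cone
  $\{t x : 0 < t \le 1, x \in A\}$, which is the push-forward of Lebesgue measure on the
  punctured ball under $x \mapsto x / |x|$. The total factor is
  $2^n n! (2n+2) = 2^{n+1} (n+1)!$.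
\<close>

definition sphere_volume :: "(complex ^ 'd::finite) measure" where
  "sphere_volume =
     scale_measure (2 ^ CARD('d) * fact CARD('d))
       (distr (restrict_space lborel (cball 0 1 - {0})) csphere (\<lambda>x. x /\<^sub>R norm x))"

inductive zzbar_polynomial :: "(complex ^ 'd::finite \<Rightarrow> complex) \<Rightarrow> bool" where
  const: "zzbar_polynomial (\<lambda>z. c)"
| coord: "zzbar_polynomial (\<lambda>z. z $ j)"
| cnj_coord: "zzbar_polynomial (\<lambda>z. cnj (z $ j))"
| add: "zzbar_polynomial f \<Longrightarrow> zzbar_polynomial g \<Longrightarrow> zzbar_polynomial (\<lambda>z. f z + g z)"
| mult: "zzbar_polynomial f \<Longrightarrow> zzbar_polynomial g \<Longrightarrow> zzbar_polynomial (\<lambda>z. f z * g z)"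

definition bihom_polys :: "nat \<Rightarrow> nat \<Rightarrow> (complex ^ 'd::finite \<Rightarrow> complex) set" where
  "bihom_polys w w' =
     {g. zzbar_polynomial g \<and> (\<forall>c z. g (c *s z) = c ^ w * cnj c ^ w' * g z)}"

definition bihom_polys_upto :: "nat \<Rightarrow> nat \<Rightarrow> (complex ^ 'd::finite \<Rightarrow> complex) set" where
  "bihom_polys_upto w w' = (\<Union>v\<in>{..w}. \<Union>v'\<in>{..w'}. bihom_polys v v')"

definition mean_zero_polys :: "nat \<Rightarrow> nat \<Rightarrow> (complex ^ 'd::finite \<Rightarrow> complex) set" where
  "mean_zero_polys w w' =
     {g \<in> bihom_polys_upto w w'. integral\<^sup>L sphere_volume g = 0}"

definition Mc :: "nat \<Rightarrow> nat \<Rightarrow> (complex ^ 'd::finite) measure set" where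
  "Mc w w' =
     {\<nu>. sets \<nu> = sets csphere \<and> prob_space \<nu> \<and>
         (\<exists>A. countable A \<and> (AE x in \<nu>. x \<in> A)) \<and>
         (\<forall>g\<in>mean_zero_polys w w'. integral\<^sup>L \<nu> g = 0)}"

text \<open>
  The support \<open>{x\<^sub>i}\<close> of a measure $\nu = \sum_i \nu_i \delta_{x_i}$ carried by countably
  many points is its set of atoms (not the closure of that set).
\<close>

definition atoms :: "'a measure \<Rightarrow> 'a set" where
  "atoms \<nu> = {x \<in> space \<nu>. measure \<nu> {x} > 0}"

text \<open>Valued in \<open>ennreal\<close> because for $\theta < 1$ the sum over infinitely many atoms may diverge.\<close>

definition theta_sum :: "real \<Rightarrow> 'a measure \<Rightarrow> ennreal" where
  "theta_sum \<theta> \<nu> = (\<Sum>\<^sub>\<infinity>x\<in>atoms \<nu>. ennreal (measure \<nu> {x} powr \<theta>))"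

definition Theta :: "'d::finite itself \<Rightarrow> nat \<Rightarrow> nat \<Rightarrow> real \<Rightarrow> ennreal" where
  "Theta _ w w' \<theta> = (INF \<nu>\<in>(Mc w w' :: (complex ^ 'd) measure set). theta_sum \<theta> \<nu>)"

definition regular_simplex_vertices :: "nat \<Rightarrow> 'a::euclidean_space set \<Rightarrow> bool" where
  "regular_simplex_vertices m V \<longleftrightarrow>
     card V = m + 1 \<and> \<not> affine_dependent V \<and> (\<exists>l. pairwise (\<lambda>x y. dist x y = l) V)"

end

theory Submission
  imports Defs
begin

text \<open>
  Put $N = n + 1$, the complex dimension. A probability measure \<open>\<nu>\<close> on the sphere annihilates the
  mean-zero polynomials of bidegree at most \<open>(1, 1)\<close> if and only if it is isotropic: it has mean
  zero and $\int z_j \bar z_k \, d\nu = \delta_{jk} / N$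
  (lemma \<open>vanishing_on_mean_zero_polys_iff_isotropic\<close>). This rests on two facts: polynomials of
  such a bidegree are combinations of \<open>1\<close>, $z_j$, $\bar z_k$, $z_j \bar z_k$ (lemma
  \<open>bihom_polys_words\<close>), and the sphere volume has the stated moments up to its total mass, by
  symmetry under sign changes and exchanges of coordinates.

  Lift a point \<open>z\<close> of the sphere to $v_z = (1, \sqrt N z) \in \mathbb{C}^{N+1}$, a vector of squared
  length $N + 1$. Isotropy says that $\int v_z v_z^* \, d\nu$ is the identity, so
  $\int |\langle v_z, v_x\rangle|^2 \, d\nu(z) = N + 1$ for every unit vector \<open>x\<close>. If \<open>x\<close> is an atom
  of mass \<open>p\<close>, then the point \<open>x\<close> alone contributes $p (N + 1)^2$; therefore $p \le 1 / (N + 1)$,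
  and in the case of equality all other atoms \<open>y\<close> satisfy $\langle v_y, v_x\rangle = 0$, that is
  $\langle y, x\rangle = - 1 / N$ (lemma \<open>isotropic_atom_le\<close>).

  The masses $p_i$ of the atoms add up to \<open>1\<close>, and $p_i \le 1 / (N + 1)$ gives
  $p_i^\theta = p_i\, p_i^{\theta - 1} \ge (N + 1)^{1 - \theta} p_i$. Summation yields the lower
  bound, with equality exactly if all masses are $1 / (N + 1)$ (lemma \<open>infsum_powr_ge\<close>). In that
  case there are $N + 1 = n + 2$ atoms with pairwise inner product $- 1 / N$, the vertices of a regular
  simplex. Conversely, an isotropic uniform measure on $N + 1$ listed points has atoms of mass at least
  $1 / (N + 1)$, hence exactly this mass. That the infimum is attained is shown by points built from
  roots of unity (lemma \<open>exists_measure_with_large_atoms\<close>).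
\<close>

section \<open>Bihomogeneous polynomials as sums of words\<close>

text \<open>
  A monomial in the coordinates and their conjugates is encoded as a word whose letter \<open>(True, j)\<close>
  stands for \<open>z $ j\<close> and \<open>(False, j)\<close> for \<open>cnj (z $ j)\<close>. With words, products of
  polynomials are concatenations, and monomials of low degree are found by case analysis on a list.
\<close>

definition word_monomial :: "(bool \<times> 'd) list \<Rightarrow> complex ^ 'd::finite \<Rightarrow> complex" where
  "word_monomial l z = prod_list (map (\<lambda>(b, j). if b then z $ j else cnj (z $ j)) l)"

lemma word_monomial_simps [simp]:
  "word_monomial [] z = 1"
  "word_monomial ((True, j) # l) z = z $ j * word_monomial l z"
  "word_monomial ((False, j) # l) z = cnj (z $ j) * word_monomial l z"
  by (simp_all add: word_monomial_def)

lemma word_monomial_append: "word_monomial (l @ l') z = word_monomial l z * word_monomial l' z"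
  by (simp add: word_monomial_def)

abbreviation holo_degree :: "(bool \<times> 'd) list \<Rightarrow> nat" where
  "holo_degree l \<equiv> length (filter fst l)"

abbreviation antiholo_degree :: "(bool \<times> 'd) list \<Rightarrow> nat" where
  "antiholo_degree l \<equiv> length (filter (Not \<circ> fst) l)"

lemma word_monomial_scale:
  "word_monomial l (c *s z) = c ^ holo_degree l * cnj c ^ antiholo_degree l * word_monomial l z"
proof (induction l)
  case (Cons a l)
  then show ?case by (cases a; cases "fst a") auto
qed simp

lemma zzbar_polynomial_words:
  assumes "zzbar_polynomial f"
  shows "\<exists>cs. f = (\<lambda>z. \<Sum>(c, l)\<leftarrow>cs. c * word_monomial l z)"
  using assms
proof induction
  case (const c)
  show ?case by (rule exI[of _ "[(c, [])]"]) simp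
next
  case (coord j)
  show ?case by (rule exI[of _ "[(1, [(True, j)])]"]) simp
next
  case (cnj_coord j)
  show ?case by (rule exI[of _ "[(1, [(False, j)])]"]) simp
next
  case (add f g)
  then obtain cs ds where "f = (\<lambda>z. \<Sum>(c, l)\<leftarrow>cs. c * word_monomial l z)"
    "g = (\<lambda>z. \<Sum>(c, l)\<leftarrow>ds. c * word_monomial l z)" by blast
  then show ?case by (intro exI[of _ "cs @ ds"]) simp
next
  case (mult f g)
  then obtain cs ds where *: "f = (\<lambda>z. \<Sum>(c, l)\<leftarrow>cs. c * word_monomial l z)"
    "g = (\<lambda>z. \<Sum>(c, l)\<leftarrow>ds. c * word_monomial l z)" by blast
  have row: "(\<Sum>(d, k)\<leftarrow>map (\<lambda>(d, k). (c * d, l @ k)) ds. d * word_monomial k z) =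
      c * word_monomial l z * (\<Sum>(d, k)\<leftarrow>ds. d * word_monomial k z)" for c l z
    by (induction ds) (auto simp: word_monomial_append algebra_simps)
  have "(\<Sum>(c, l)\<leftarrow>cs. c * word_monomial l z) * (\<Sum>(d, k)\<leftarrow>ds. d * word_monomial k z) =
     (\<Sum>(c, l)\<leftarrow>concat (map (\<lambda>(c, l). map (\<lambda>(d, k). (c * d, l @ k)) ds) cs). c * word_monomial l z)"
    for z
    by (induction cs) (auto simp: row algebra_simps simp del: map_map)
  then show ?case unfolding * by blast
qed

text \<open>
  Comparison of coefficients in the form in which it is used below: the exponents \<open>k i\<close> are allowed
  to repeat, and the identity of polynomial functions is known only on an infinite set.
\<close>

lemma power_sum_coefficient:
  fixes y :: "'a::idom"
  assumes "infinite S" and "\<And>v. v \<in> S \<Longrightarrow> (\<Sum>i\<leftarrow>is. x i * v ^ k i) = y * v ^ w"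
  shows "(\<Sum>i\<leftarrow>filter (\<lambda>i. k i = w) is. x i) = y"
proof -
  define p where "p = (\<Sum>i\<leftarrow>is. monom (x i) (k i)) - monom y w"
  have poly_sum: "poly (\<Sum>i\<leftarrow>js. monom (x i) (k i)) v = (\<Sum>i\<leftarrow>js. x i * v ^ k i)" for js v
    by (induction js) (auto simp: poly_monom)
  have coeff_sum: "coeff (\<Sum>i\<leftarrow>js. monom (x i) (k i)) w = (\<Sum>i\<leftarrow>filter (\<lambda>i. k i = w) js. x i)" for js
    by (induction js) auto
  have "S \<subseteq> {v. poly p v = 0}"
    using assms(2) by (auto simp: p_def poly_sum poly_monom)
  then have "p = 0"
    using assms(1) poly_roots_finite finite_subset by blast
  then have "coeff p w = 0" by simp
  then show ?thesis by (simp add: p_def coeff_sum)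
qed

lemma infinite_unit_circle: "infinite (sphere 0 1 :: complex set)"
proof -
  have "connected (sphere 0 1 :: complex set)"
    by (intro connected_sphere) simp
  then show ?thesis
    by (metis connected_finite_iff_sing insertE empty_iff mem_sphere_0 norm_one norm_minus_cancel
        one_neq_neg_one)
qed

text \<open>
  Bidegree is defined by the behaviour under scaling, so it has to be shown that a polynomial which
  scales like $c^w \bar c^{w'}$ has only monomials that scale in this way. Coefficients are compared
  twice in \<open>g (c *s z)\<close> with \<open>z\<close> fixed: for real \<open>c\<close> the word \<open>l\<close> contributes a multiple of
  $c^{|l|}$, so only words of length \<open>w + w'\<close> remain; for \<open>c\<close> on the unit circle, after
  multiplication by $c^{w + w'}$, such a word contributes a multiple of $(c^2)^a$ with \<open>a\<close> its
  holomorphic degree, and the right-hand side is a multiple of $(c^2)^w$.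
\<close>

lemma bihom_polys_words:
  assumes "g \<in> bihom_polys w w'"
  obtains cs where "\<And>c l. (c, l) \<in> set cs \<Longrightarrow> holo_degree l = w \<and> antiholo_degree l = w'"
    and "g = (\<lambda>z. \<Sum>(c, l)\<leftarrow>cs. c * word_monomial l z)"
proof -
  have "zzbar_polynomial g" and hom: "\<And>c z. g (c *s z) = c ^ w * cnj c ^ w' * g z"
    using assms by (auto simp: bihom_polys_def)
  then obtain cs where g: "g = (\<lambda>z. \<Sum>(c, l)\<leftarrow>cs. c * word_monomial l z)"
    using zzbar_polynomial_words by blast
  define total where "total = filter (\<lambda>(c, l). length l = w + w') cs"
  define part where "part = filter (\<lambda>(c, l). holo_degree l = w) total"
  have len: "holo_degree l + antiholo_degree l = length l" for l :: "(bool \<times> 'a) list"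
    by (induction l) auto
  have "(\<Sum>(c, l)\<leftarrow>part. c * word_monomial l z) = g z" for z
  proof -
    have 1: "(\<Sum>(c, l)\<leftarrow>total. c * word_monomial l (u *s z)) = u ^ w * cnj u ^ w' * g z" for u
    proof -
      have "(\<Sum>i\<leftarrow>filter (\<lambda>i. length (snd i) = w + w') cs. fst i * word_monomial (snd i) (u *s z)) = g (u *s z)"
      proof (rule power_sum_coefficient[of "complex_of_real ` UNIV"])
        show "infinite (range complex_of_real)"
          using infinite_UNIV_char_0 finite_imageD[of complex_of_real UNIV] inj_of_real by blast
        fix v assume "v \<in> range complex_of_real"
        then have cnj: "cnj v = v" by auto
        have "(\<Sum>i\<leftarrow>cs. fst i * word_monomial (snd i) (u *s z) * v ^ length (snd i)) = g (v *s (u *s z))"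
          unfolding g word_monomial_scale[where c = v]
        proof (intro arg_cong[where f = sum_list] map_cong refl)
          fix i :: "complex \<times> (bool \<times> 'a) list"
          have "v ^ length (snd i) = v ^ holo_degree (snd i) * v ^ antiholo_degree (snd i)"
            unfolding power_add[symmetric] len ..
          then show "fst i * word_monomial (snd i) (u *s z) * v ^ length (snd i) =
            (case i of (c, l) \<Rightarrow>
              c * (v ^ holo_degree l * cnj v ^ antiholo_degree l * word_monomial l (u *s z)))"
            by (simp add: cnj case_prod_unfold mult_ac)
        qed
        also have "\<dots> = g (u *s z) * v ^ (w + w')"
          by (subst hom) (simp add: cnj power_add)
        finally show "(\<Sum>i\<leftarrow>cs. fst i * word_monomial (snd i) (u *s z) * v ^ length (snd i)) = g (u *s z) * v ^ (w + w')" .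
      qed
      then show ?thesis by (simp add: total_def case_prod_unfold hom)
    qed
    have "(\<Sum>i\<leftarrow>filter (\<lambda>i. holo_degree (snd i) = w) total. fst i * word_monomial (snd i) z) = g z"
    proof (rule power_sum_coefficient[of "sphere 0 1"])
      fix v :: complex assume v: "v \<in> sphere 0 1"
      \<comment> \<open>The variable \<open>v\<close> plays the part of $u^2$, because $u^{w + w'} u^a \bar u^b = u^{2 a}$
        whenever $|u| = 1$ and $a + b = w + w'$.\<close>
      define u where "u = csqrt v"
      have u: "u\<^sup>2 = v" "u * cnj u = 1"
      proof -
        show u2: "u\<^sup>2 = v" by (simp add: u_def)
        then have "(norm u)\<^sup>2 = 1" using v by (metis mem_sphere_0 norm_power)
        then show "u * cnj u = 1" by (simp add: complex_norm_square[symmetric])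
      qed
      have *: "u ^ (w + w') * (u ^ a * cnj u ^ b) = v ^ a" if "a + b = w + w'" for a b
      proof -
        have *: "u ^ (w + w') * (u ^ a * cnj u ^ b) = (u\<^sup>2) ^ a * (u * cnj u) ^ b"
          by (simp add: that[symmetric] power_add power_mult_distrib power2_eq_square mult_ac)
        then show ?thesis by (simp add: u)
      qed
      have "(\<Sum>i\<leftarrow>total. fst i * word_monomial (snd i) z * v ^ holo_degree (snd i)) =
         u ^ (w + w') * (\<Sum>(c, l)\<leftarrow>total. c * word_monomial l (u *s z))"
        unfolding sum_list_const_mult[symmetric] word_monomial_scale
      proof (intro arg_cong[where f = sum_list] map_cong refl)
        fix i assume "i \<in> set total"
        then have "holo_degree (snd i) + antiholo_degree (snd i) = w + w'"
          unfolding len by (auto simp: total_def)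
        from *[OF this] show "fst i * word_monomial (snd i) z * v ^ holo_degree (snd i) =
            u ^ (w + w') * (case i of (c, l) \<Rightarrow>
              c * (u ^ holo_degree l * cnj u ^ antiholo_degree l * word_monomial l z))"
          by (simp add: case_prod_unfold mult_ac)
      qed
      also have "\<dots> = g z * v ^ w" unfolding 1 using *[of w w'] by (simp add: mult_ac)
      finally show "(\<Sum>i\<leftarrow>total. fst i * word_monomial (snd i) z * v ^ holo_degree (snd i)) = g z * v ^ w" .
    qed (rule infinite_unit_circle)
    then show ?thesis by (simp add: part_def case_prod_unfold)
  qed
  moreover have "holo_degree l = w \<and> antiholo_degree l = w'" if "(c, l) \<in> set part" for c l
    using that len[of l] by (auto simp: part_def total_def)
  ultimately show ?thesis by (intro that[of part]) (auto simp: fun_eq_iff)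
qed

section \<open>Symmetries and second moments of the sphere volume\<close>

lemma space_eq_sphere: "sets M = sets csphere \<Longrightarrow> space M = sphere 0 1"
  using sets_eq_imp_space_eq[of M csphere] by (simp add: csphere_def space_restrict_space)

lemma singleton_in_sets:
  assumes "sets M = sets csphere" and "x \<in> sphere 0 1"
  shows "{x} \<in> sets M"
  using assms by (simp add: csphere_def sets_restrict_space_iff)

lemma integrable_continuous_csphere:
  fixes f :: "complex ^ 'd::finite \<Rightarrow> 'b::{banach, second_countable_topology}"
  assumes "finite_measure M" and "sets M = sets csphere" and "continuous_on UNIV f"
  shows "integrable M f"
proof -
  interpret finite_measure M by fact
  have space: "space M = sphere 0 1"
    by (rule space_eq_sphere[OF assms(2)])
  have "f \<in> borel_measurable csphere"
    unfolding csphere_def using assms(3)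
    by (intro measurable_restrict_space1 borel_measurable_continuous_onI)
  then have meas: "f \<in> borel_measurable M"
    using assms(2) measurable_cong_sets by blast
  have "compact (f ` sphere 0 1)"
    using assms(3) by (intro compact_continuous_image compact_sphere) (auto intro: continuous_on_subset)
  then obtain B where "\<And>x. x \<in> sphere 0 1 \<Longrightarrow> norm (f x) \<le> B"
    by (meson bounded_iff compact_imp_bounded imageI)
  then show ?thesis
    using meas space by (intro integrable_const_bound[of _ B]) auto
qed

lemma integral_scale_measure:
  fixes f :: "'a \<Rightarrow> 'b::{banach, second_countable_topology}"
  assumes "0 \<le> r" and "f \<in> borel_measurable M"
  shows "integral\<^sup>L (scale_measure (ennreal r) M) f = r *\<^sub>R integral\<^sup>L M f"
proof -
  have "scale_measure (ennreal r) M = density M (\<lambda>_. ennreal r)"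
    by (rule measure_eqI) (simp_all add: emeasure_density_const)
  then show ?thesis
    using assms by (simp add: integral_density)
qed

lemma radial_projection_measurable:
  "(\<lambda>x. x /\<^sub>R norm x) \<in> restrict_space lborel (cball 0 1 - {0}) \<rightarrow>\<^sub>M (csphere :: (complex ^ 'd::finite) measure)"
  unfolding csphere_def
  by (intro measurable_restrict_space2 measurable_restrict_space1)
     (auto simp: space_restrict_space)

lemma sphere_volume_integral:
  fixes f :: "complex ^ 'd::finite \<Rightarrow> 'b::{banach, second_countable_topology}"
  assumes "f \<in> borel_measurable borel"
  shows "integral\<^sup>L sphere_volume f = (2 ^ CARD('d) * fact CARD('d)) *\<^sub>R
    (\<integral>x. indicator (cball 0 1 - {0}) x *\<^sub>R f (x /\<^sub>R norm x) \<partial>lborel)"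
proof -
  have "(2 ^ CARD('d) * fact CARD('d) :: ennreal) = of_nat (2 ^ CARD('d) * fact CARD('d))"
    by simp
  also have "\<dots> = ennreal (2 ^ CARD('d) * fact CARD('d))"
    unfolding ennreal_of_nat_eq_real_of_nat by simp
  finally have r: "(2 ^ CARD('d) * fact CARD('d) :: ennreal) = \<dots>" .
  have f: "f \<in> borel_measurable csphere"
    unfolding csphere_def using assms by (rule measurable_restrict_space1)
  show ?thesis
    unfolding sphere_volume_def r
    by (subst integral_scale_measure)
       (auto simp: f integral_distr[OF radial_projection_measurable f] integral_restrict_space)
qed

text \<open>
  The radial projection commutes with linear isometries, so every linear isometry that preserves
  Lebesgue measure preserves the sphere volume. Sign changes and exchanges of coordinates are
  enough to determine the moments of $z_j$ and $z_j \bar z_k$.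
\<close>

lemma sphere_volume_integral_isometry:
  fixes f :: "complex ^ 'd::finite \<Rightarrow> 'b::{banach, second_countable_topology}"
    and T :: "complex ^ 'd \<Rightarrow> complex ^ 'd"
  assumes "linear T" and "\<And>x. norm (T x) = norm x" and "distr lborel borel T = lborel"
    and [measurable]: "f \<in> borel_measurable borel"
  shows "integral\<^sup>L sphere_volume (\<lambda>x. f (T x)) = integral\<^sup>L sphere_volume f"
proof -
  have [measurable]: "T \<in> borel \<rightarrow>\<^sub>M borel"
    using assms(1) by (intro borel_measurable_continuous_onI linear_continuous_on) (simp add: linear_conv_bounded_linear)
  let ?F = "\<lambda>x. indicator (cball 0 1 - {0}) x *\<^sub>R f (x /\<^sub>R norm x)"
  have "(\<integral>x. ?F x \<partial>lborel) = (\<integral>x. ?F x \<partial>distr lborel borel T)"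
    unfolding assms(3) ..
  also have "\<dots> = (\<integral>x. ?F (T x) \<partial>lborel)"
    by (intro integral_distr borel_measurable_scaleR borel_measurable_indicator
        measurable_compose[OF _ assms(4)]) auto
  also have "(\<lambda>x. ?F (T x)) = (\<lambda>x. indicator (cball 0 1 - {0}) x *\<^sub>R f (T (x /\<^sub>R norm x)))"
  proof
    fix x
    have "T x = 0 \<longleftrightarrow> x = 0"
      using assms(2)[of x] by (metis norm_eq_zero)
    then show "?F (T x) = indicator (cball 0 1 - {0}) x *\<^sub>R f (T (x /\<^sub>R norm x))"
      by (simp add: assms(2) indicator_def linear_cmul[OF assms(1)])
  qed
  finally show ?thesis
    by (simp add: sphere_volume_integral)
qed

lemma finite_measure_sphere_volume: "finite_measure (sphere_volume :: (complex ^ 'd::finite) measure)"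
  and measure_sphere_volume_pos: "0 < measure (sphere_volume :: (complex ^ 'd) measure) (space sphere_volume)"
proof -
  let ?S = "sphere_volume :: (complex ^ 'd) measure"
  have vim: "(\<lambda>x. x /\<^sub>R norm x) -` sphere 0 1 \<inter> (cball 0 1 - {0 :: complex ^ 'd}) = cball 0 1 - {0}"
    by auto
  let ?D = "distr (restrict_space lborel (cball 0 1 - {0})) csphere (\<lambda>x :: complex ^ 'd. x /\<^sub>R norm x)"
  have space: "space csphere = (sphere 0 1 :: (complex ^ 'd) set)"
    by (rule space_eq_sphere[OF refl])
  have "emeasure ?D (space csphere) = emeasure lborel (cball 0 1 - {0 :: complex ^ 'd})"
    by (subst emeasure_distr[OF radial_projection_measurable sets.top])
       (auto simp: space space_restrict_space vim emeasure_restrict_space)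
  also have "emeasure lborel (cball 0 1 - {0 :: complex ^ 'd}) = emeasure lborel (cball 0 1 :: (complex ^ 'd) set)"
    by (rule emeasure_Diff_null_set) (auto simp: null_sets_def)
  finally have D: "emeasure ?S (space ?S) = 
      (2 ^ CARD('d) * fact CARD('d)) * emeasure lborel (cball 0 1 :: (complex ^ 'd) set)"
    by (simp add: sphere_volume_def space_scale_measure)
  have fin: "emeasure lborel (cball 0 1 :: (complex ^ 'd) set) < \<infinity>"
    by (rule emeasure_bounded_finite) simp
  have "(2 ^ CARD('d) * fact CARD('d) :: ennreal) = of_nat (2 ^ CARD('d) * fact CARD('d))"
    by simp
  also have "\<dots> < \<top>" by (rule of_nat_less_top)
  finally show finS: "finite_measure ?S"
    using fin by (intro finite_measureI) (auto simp: D ennreal_mult_eq_top_iff)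
  have "0 < measure lborel (cball 0 1 :: (complex ^ 'd) set)"
    by (rule content_cball_pos) simp
  then have "emeasure lborel (cball 0 1 :: (complex ^ 'd) set) \<noteq> 0"
    by (auto simp: measure_def)
  then have "0 < emeasure ?S (space ?S)"
    unfolding D by (simp add: zero_less_iff_neq_zero)
  then show "0 < measure ?S (space ?S)"
    using finite_measure.emeasure_eq_measure[OF finS] by simp
qed

lemma sets_sphere_volume: "sets sphere_volume = sets csphere"
  by (simp add: sphere_volume_def)

text \<open>
  Lebesgue measure is characterised by the volume of boxes. The preimage of a box is the box with
  permuted corners, whose volume is the same product in a different order.
\<close>

lemma distr_lborel_Basis_permutation:
  fixes T :: "'a::euclidean_space \<Rightarrow> 'a"
  assumes "linear T" and "T \<circ> T = id" and "T ` Basis = Basis" and "\<And>x y. T x \<bullet> T y = x \<bullet> y"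
  shows "distr lborel borel T = lborel"
proof (rule lborel_eqI[symmetric])
  have [measurable]: "T \<in> borel \<rightarrow>\<^sub>M borel"
    using assms(1) by (intro borel_measurable_continuous_onI linear_continuous_on) (simp add: linear_conv_bounded_linear)
  have TT: "T (T x) = x" for x using assms(2) by (simp add: fun_eq_iff)
  have inner: "T x \<bullet> y = x \<bullet> T y" for x y using assms(4)[of x "T y"] by (simp add: TT)
  have inj: "inj_on T Basis" by (rule inj_on_inverseI[of _ T]) (rule TT)
  fix l u :: 'a assume le: "\<And>b. b \<in> Basis \<Longrightarrow> l \<bullet> b \<le> u \<bullet> b"
  have "T x \<in> box l u \<longleftrightarrow> x \<in> box (T l) (T u)" for x
  proof -
    have "T x \<in> box l u \<longleftrightarrow> (\<forall>b\<in>T ` Basis. l \<bullet> b < T x \<bullet> b \<and> T x \<bullet> b < u \<bullet> b)"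
      unfolding assms(3) by (simp add: box_def)
    also have "\<dots> \<longleftrightarrow> x \<in> box (T l) (T u)"
      unfolding ball_simps assms(4) by (simp add: box_def inner TT)
    finally show ?thesis .
  qed
  then have "T -` box l u = box (T l) (T u)"
    by auto
  then have "emeasure (distr lborel borel T) (box l u) = emeasure lborel (box (T l) (T u))"
    by (simp add: emeasure_distr)
  also have "\<dots> = (\<Prod>b\<in>Basis. (T u - T l) \<bullet> b)"
  proof (rule emeasure_lborel_box)
    fix b :: 'a assume "b \<in> Basis"
    then have "T b \<in> Basis" using assms(3) by blast
    then show "T l \<bullet> b \<le> T u \<bullet> b" unfolding inner by (rule le)
  qed
  also have "\<dots> = (\<Prod>b\<in>T ` Basis. (T u - T l) \<bullet> b)"
    unfolding assms(3) ..
  also have "\<dots> = (\<Prod>b\<in>Basis. (u - l) \<bullet> b)"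
    unfolding prod.reindex[OF inj] by (simp add: inner_diff_left assms(4))
  finally show "emeasure (distr lborel borel T) (box l u) = (\<Prod>b\<in>Basis. (u - l) \<bullet> b)" .
qed simp

lemma distr_lborel_sign_change:
  fixes T :: "'a::euclidean_space \<Rightarrow> 'a"
  assumes T: "\<And>x b. b \<in> Basis \<Longrightarrow> T x \<bullet> b = c b * (x \<bullet> b)"
    and c: "\<And>b. b \<in> Basis \<Longrightarrow> \<bar>c b\<bar> = 1"
  shows "distr lborel borel T = lborel"
proof -
  have "T = (\<lambda>x. 0 + (\<Sum>j\<in>Basis. (c j * (x \<bullet> j)) *\<^sub>R j))"
    by (rule ext, rule euclidean_eqI) (simp add: T)
  moreover have "c b \<noteq> 0" if "b \<in> Basis" for b
    using c[OF that] by auto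
  ultimately have "lborel = density (distr lborel borel T) (\<lambda>_. ennreal (\<Prod>j\<in>Basis. \<bar>c j\<bar>))"
    using lborel_affine_euclidean[of c 0] by simp
  also have "\<dots> = distr lborel borel T"
    by (simp add: c density_1)
  finally show ?thesis ..
qed

definition flip_coord :: "'d \<Rightarrow> complex ^ 'd::finite \<Rightarrow> complex ^ 'd" where
  "flip_coord j z = (\<chi> i. if i = j then - (z $ i) else z $ i)"

definition swap_coords :: "'d \<Rightarrow> 'd \<Rightarrow> complex ^ 'd::finite \<Rightarrow> complex ^ 'd" where
  "swap_coords j k z = (\<chi> i. z $ Transposition.transpose j k i)"

lemma sphere_volume_integral_flip_coord:
  fixes f :: "complex ^ 'd::finite \<Rightarrow> complex"
  assumes "f \<in> borel_measurable borel"
  shows "integral\<^sup>L sphere_volume (\<lambda>z. f (flip_coord j z)) = integral\<^sup>L sphere_volume f"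
proof (rule sphere_volume_integral_isometry)
  show "linear (flip_coord j)"
    by (intro linearI) (auto simp: flip_coord_def vec_eq_iff)
  show "norm (flip_coord j z) = norm z" for z :: "complex ^ 'd"
    unfolding norm_vec_def flip_coord_def by (intro L2_set_cong) auto
  show "distr lborel borel (flip_coord j) = lborel"
  proof (rule distr_lborel_sign_change[where c = "\<lambda>b. if b $ j = 0 then 1 else -1"])
    fix x b :: "complex ^ 'd" assume "b \<in> Basis"
    then obtain i u where "b = axis i u" "u \<in> Basis" by (auto simp: Basis_vec_def)
    then show "flip_coord j x \<bullet> b = (if b $ j = 0 then 1 else -1) * (x \<bullet> b)"
      using nonzero_Basis[of u] by (cases "i = j") (simp_all add: inner_axis flip_coord_def, simp_all add: axis_def)
  qed auto
qed fact

lemma sphere_volume_integral_swap_coords: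
  fixes f :: "complex ^ 'd::finite \<Rightarrow> complex"
  assumes "f \<in> borel_measurable borel"
  shows "integral\<^sup>L sphere_volume (\<lambda>z. f (swap_coords j k z)) = integral\<^sup>L sphere_volume f"
proof (rule sphere_volume_integral_isometry)
  show lin: "linear (swap_coords j k)"
    by (intro linearI) (auto simp: swap_coords_def vec_eq_iff)
  have inner: "swap_coords j k x \<bullet> swap_coords j k y = x \<bullet> y" for x y :: "complex ^ 'd"
  proof -
    have "(\<Sum>i\<in>UNIV. x $ Transposition.transpose j k i \<bullet> y $ Transposition.transpose j k i) = (\<Sum>i\<in>UNIV. x $ i \<bullet> y $ i)"
      by (rule sum.reindex_bij_witness[of _ "Transposition.transpose j k" "Transposition.transpose j k"]) auto
    then show ?thesis by (simp add: inner_vec_def swap_coords_def)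
  qed
  then show "norm (swap_coords j k z) = norm z" for z :: "complex ^ 'd"
    by (simp add: norm_eq_sqrt_inner)
  have invol: "swap_coords j k \<circ> swap_coords j k = (id :: complex ^ 'd \<Rightarrow> _)"
    by (simp add: fun_eq_iff swap_coords_def vec_eq_iff)
  have axis: "swap_coords j k (axis i u) = axis (Transposition.transpose j k i) u" for i and u :: complex
    by (auto simp: swap_coords_def vec_eq_iff axis_def Transposition.transpose_def)
  have "swap_coords j k ` Basis \<subseteq> (Basis :: (complex ^ 'd) set)"
  proof
    fix b assume "b \<in> swap_coords j k ` (Basis :: (complex ^ 'd) set)"
    then obtain i u where "b = swap_coords j k (axis i u)" "u \<in> Basis"
      by (auto simp: Basis_vec_def)
    then show "b \<in> Basis" unfolding axis by (auto simp: Basis_vec_def)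
  qed
  moreover have "Basis \<subseteq> swap_coords j k ` (Basis :: (complex ^ 'd) set)"
    using image_mono[OF calculation, of "swap_coords j k"] unfolding image_comp invol by simp
  ultimately show "distr lborel borel (swap_coords j k) = lborel"
    by (intro distr_lborel_Basis_permutation[OF lin invol _ inner] subset_antisym)
qed fact

lemma sphere_volume_first_moment: "(\<integral>z. z $ j \<partial>sphere_volume) = 0"
proof -
  have "(\<integral>z. z $ j \<partial>sphere_volume) = (\<integral>z. flip_coord j z $ j \<partial>sphere_volume)"
    by (intro sphere_volume_integral_flip_coord[where f = "\<lambda>z. z $ j", symmetric]
        borel_measurable_continuous_onI continuous_intros)
  then show ?thesis by (simp add: flip_coord_def)
qed

lemma sum_coord_mult_cnj_eq_1:
  fixes z :: "complex ^ 'd::finite"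
  assumes "sets M = sets csphere" and "z \<in> space M"
  shows "(\<Sum>i\<in>UNIV. z $ i * cnj (z $ i)) = 1"
proof -
  have "norm z = 1"
    using assms(2) by (simp add: space_eq_sphere[OF assms(1)])
  then have "(\<Sum>i\<in>UNIV. (norm (z $ i))\<^sup>2) = 1"
    by (simp add: norm_vec_def L2_set_def)
  then show ?thesis
    unfolding complex_norm_square[symmetric] of_real_sum[symmetric] by simp
qed

text \<open>
  The off-diagonal moments are odd under a sign change of one coordinate. The diagonal ones agree
  by exchange of coordinates, and they add up to the total mass because $\sum_j |z_j|^2 = 1$.
\<close>

lemma sphere_volume_second_moment:
  fixes j k :: "'d::finite"
  shows "(\<integral>z. z $ j * cnj (z $ k) \<partial>sphere_volume) =
    (if j = k then complex_of_real (measure (sphere_volume :: (complex ^ 'd) measure) (space sphere_volume)) / of_nat CARD('d) else 0)"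
proof -
  let ?S = "sphere_volume :: (complex ^ 'd) measure"
  have cont: "continuous_on UNIV (\<lambda>z :: complex ^ 'd. z $ j * cnj (z $ k))" for j k
    by (intro continuous_intros)
  have meas: "(\<lambda>z :: complex ^ 'd. z $ j * cnj (z $ k)) \<in> borel_measurable borel" for j k
    by (rule borel_measurable_continuous_onI) (rule cont)
  show ?thesis
  proof (cases "j = k")
    case False
    have "(\<integral>z. z $ j * cnj (z $ k) \<partial>?S) = (\<integral>z. flip_coord j z $ j * cnj (flip_coord j z $ k) \<partial>?S)"
      by (rule sphere_volume_integral_flip_coord[OF meas, symmetric])
    then show ?thesis using False by (simp add: flip_coord_def)
  next
    case True
    have same: "(\<integral>z. z $ i * cnj (z $ i) \<partial>?S) = (\<integral>z. z $ k * cnj (z $ k) \<partial>?S)" for i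
    proof -
      have "(\<integral>z. swap_coords i k z $ k * cnj (swap_coords i k z $ k) \<partial>?S) = (\<integral>z. z $ k * cnj (z $ k) \<partial>?S)"
        by (rule sphere_volume_integral_swap_coords[OF meas])
      then show ?thesis by (simp add: swap_coords_def)
    qed
    have "of_nat CARD('d) * (\<integral>z. z $ k * cnj (z $ k) \<partial>?S) = (\<Sum>i\<in>(UNIV :: 'd set). \<integral>z. z $ k * cnj (z $ k) \<partial>?S)"
      by simp
    also have "\<dots> = (\<Sum>i\<in>UNIV. \<integral>z. z $ i * cnj (z $ i) \<partial>?S)"
      by (intro sum.cong refl same[symmetric])
    also have "\<dots> = (\<integral>z. (\<Sum>i\<in>UNIV. z $ i * cnj (z $ i)) \<partial>?S)"
      by (rule Bochner_Integration.integral_sum[symmetric])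
        (rule integrable_continuous_csphere[OF finite_measure_sphere_volume sets_sphere_volume cont])
    also have "\<dots> = (\<integral>z. 1 \<partial>?S)"
      by (intro Bochner_Integration.integral_cong refl sum_coord_mult_cnj_eq_1[OF sets_sphere_volume])
    also have "\<dots> = of_real (measure ?S (space ?S))"
      by (simp add: scaleR_conv_of_real)
    finally show ?thesis using True by (simp add: nonzero_eq_divide_eq mult.commute)
  qed
qed

section \<open>Isotropic measures\<close>

text \<open>
  The moments of $z_j$ and $z_j \bar z_k$ under the normalised sphere volume. For a
  probability measure and the vectors $v = (1, \sqrt{n+1}\, z) \in \mathbb{C}^{n+2}$ this says that
  the average of the operators $v v^*$ is the identity.
\<close>

definition isotropic :: "(complex ^ 'd::finite) measure \<Rightarrow> bool" where
  "isotropic \<nu> \<longleftrightarrow> (\<forall>j. (\<integral>z. z $ j \<partial>\<nu>) = 0) \<and>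
     (\<forall>j k. (\<integral>z. z $ j * cnj (z $ k) \<partial>\<nu>) = (if j = k then 1 / of_nat CARD('d) else 0))"

lemma continuous_on_word_monomial: "continuous_on UNIV (word_monomial l)"
proof (induction l)
  case Nil
  show ?case by (simp add: word_monomial_def)
next
  case (Cons a l)
  obtain b j where a: "a = (b, j)" by fastforce
  have "word_monomial (a # l) = (\<lambda>z. (if b then z $ j else cnj (z $ j)) * word_monomial l z)"
    by (cases b) (auto simp: a)
  then show ?case using Cons by (cases b) (auto intro!: continuous_intros)
qed

lemma integral_word_sum:
  assumes "finite_measure M" and "sets M = sets csphere"
  shows "(\<integral>z. (\<Sum>(c, l)\<leftarrow>cs. c * word_monomial l z) \<partial>M) = (\<Sum>(c, l)\<leftarrow>cs. c * (\<integral>z. word_monomial l z \<partial>M))"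
proof (induction cs)
  case (Cons a cs)
  obtain c l where a: "a = (c, l)" by fastforce
  have "continuous_on UNIV (\<lambda>z. \<Sum>(c, l)\<leftarrow>cs. c * word_monomial l z)"
    by (induction cs) (auto intro!: continuous_intros continuous_on_word_monomial)
  then have tail: "integrable M (\<lambda>z. \<Sum>(c, l)\<leftarrow>cs. c * word_monomial l z)"
    by (rule integrable_continuous_csphere[OF assms])
  have head: "integrable M (\<lambda>z. c * word_monomial l z)"
    by (intro integrable_continuous_csphere[OF assms] continuous_on_mult continuous_on_const
        continuous_on_word_monomial)
  show ?case
    using Bochner_Integration.integral_add[OF head tail] Cons by (simp add: a)
qed simp

text \<open>
  A word with at most one letter of each kind is empty, a single coordinate, or a product
  $z_j \bar z_k$ in one of the two orders, so its integral is one of the prescribed moments.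
\<close>

lemma isotropic_integral_word_monomial:
  fixes \<nu> :: "(complex ^ 'd::finite) measure"
  assumes "prob_space \<nu>" and "isotropic \<nu>" and "holo_degree l \<le> 1" and "antiholo_degree l \<le> 1"
  shows "(\<integral>z. word_monomial l z \<partial>sphere_volume) =
    of_real (measure (sphere_volume :: (complex ^ 'd) measure) (space sphere_volume)) *
    (\<integral>z. word_monomial l z \<partial>\<nu>)"
proof -
  interpret prob_space \<nu> by fact
  have first: "(\<integral>z. z $ j \<partial>\<nu>) = 0" for j
    using assms(2) by (simp add: isotropic_def)
  have second: "(\<integral>z. z $ j * cnj (z $ k) \<partial>\<nu>) = (if j = k then 1 / of_nat CARD('d) else 0)"
    "(\<integral>z. cnj (z $ k) * z $ j \<partial>\<nu>) = (if j = k then 1 / of_nat CARD('d) else 0)"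
    "(\<integral>z. cnj (z $ k) * z $ j \<partial>sphere_volume) =
      (if j = k then of_real (measure (sphere_volume :: (complex ^ 'd) measure) (space sphere_volume)) / of_nat CARD('d) else 0)"
    for j k :: 'd
    using assms(2) sphere_volume_second_moment[of j k] by (simp_all add: isotropic_def mult.commute)
  consider "l = []" | j where "l = [(True, j)]" | j where "l = [(False, j)]"
    | j k where "l = [(True, j), (False, k)]" | j k where "l = [(False, k), (True, j)]"
  proof (cases l)
    case 1: (Cons a l')
    show thesis
    proof (cases l')
      case Nil
      then show thesis using 1 that(2,3) by (cases a; cases "fst a") auto
    next
      case 2: (Cons b l'')
      obtain s j t k where ab: "a = (s, j)" "b = (t, k)" by (metis surj_pair)
      have "l'' = []"
        using assms(3,4) 1 2 ab by (cases l''; cases s; cases t; cases "fst (hd l'')") auto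
      then show thesis
        using assms(3,4) 1 2 ab that(4,5) by (cases s; cases t) auto
    qed
  qed
  then show ?thesis
  proof cases
    case 1
    then show ?thesis by (simp add: scaleR_conv_of_real prob_space)
  qed (simp_all add: sphere_volume_first_moment first second sphere_volume_second_moment)
qed

text \<open>
  For the forward direction, the test polynomials $z_j$, $z_j \bar z_k$ and $|z_j|^2 - |z_k|^2$ have
  mean zero, and the common value of the integrals of $|z_j|^2$ is fixed by $\sum_j |z_j|^2 = 1$.
  Conversely, an isotropic probability measure integrates each polynomial of bidegree at most
  \<open>(1, 1)\<close> to its average over the sphere; the positivity of the total volume then allows the
  passage from mean zero for the sphere volume to mean zero for \<open>\<nu>\<close>.
\<close>

lemma vanishing_on_mean_zero_polys_iff_isotropic:
  fixes \<nu> :: "(complex ^ 'd::finite) measure"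
  assumes "prob_space \<nu>" and sets: "sets \<nu> = sets csphere"
  shows "(\<forall>g\<in>mean_zero_polys 1 1. integral\<^sup>L \<nu> g = 0) \<longleftrightarrow> isotropic \<nu>"
proof
  interpret prob_space \<nu> by fact
  let ?S = "sphere_volume :: (complex ^ 'd) measure"
  note integrable = integrable_continuous_csphere[OF finite_measure_axioms sets]
    integrable_continuous_csphere[OF finite_measure_sphere_volume sets_sphere_volume]
  note zzbar = zzbar_polynomial.intros
  {
    assume vanish: "\<forall>g\<in>mean_zero_polys 1 1. integral\<^sup>L \<nu> g = 0"
    have bihom_vanish: "integral\<^sup>L \<nu> g = 0"
      if "g \<in> bihom_polys w w'" "w \<le> 1" "w' \<le> 1" "integral\<^sup>L ?S g = 0" for g w w'
      using vanish that by (auto simp: mean_zero_polys_def bihom_polys_upto_def)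
    have first: "(\<integral>z. z $ j \<partial>\<nu>) = 0" for j
      by (rule bihom_vanish[of _ 1 0])
         (auto simp: bihom_polys_def sphere_volume_first_moment intro: zzbar)
    have off_diagonal: "(\<integral>z. z $ j * cnj (z $ k) \<partial>\<nu>) = 0" if "j \<noteq> k" for j k
      using that by (intro bihom_vanish[of _ 1 1])
         (auto simp: bihom_polys_def sphere_volume_second_moment intro: zzbar)
    have same: "(\<integral>z. z $ j * cnj (z $ j) \<partial>\<nu>) = (\<integral>z. z $ k * cnj (z $ k) \<partial>\<nu>)" for j k
    proof -
      have cont: "continuous_on UNIV (\<lambda>z :: complex ^ 'd. z $ j * cnj (z $ j))"
        "continuous_on UNIV (\<lambda>z :: complex ^ 'd. - 1 * (z $ j * cnj (z $ j)))" for j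
        by (intro continuous_intros)+
      have "(\<integral>z. z $ j * cnj (z $ j) + - 1 * (z $ k * cnj (z $ k)) \<partial>\<nu>) = 0"
      proof (rule bihom_vanish[of _ 1 1])
        show "(\<lambda>z :: complex ^ 'd. z $ j * cnj (z $ j) + - 1 * (z $ k * cnj (z $ k))) \<in> bihom_polys 1 1"
          unfolding bihom_polys_def
          by (intro CollectI conjI zzbar) (simp add: algebra_simps)
        show "(\<integral>z. z $ j * cnj (z $ j) + - 1 * (z $ k * cnj (z $ k)) \<partial>?S) = 0"
          by (subst Bochner_Integration.integral_add)
             (simp_all add: integrable cont sphere_volume_second_moment)
      qed auto
      then show ?thesis
        by (subst (asm) Bochner_Integration.integral_add) (simp_all add: integrable cont)
    qed
    have diagonal: "(\<integral>z. z $ j * cnj (z $ j) \<partial>\<nu>) = 1 / of_nat CARD('d)" for j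
    proof -
      have "of_nat CARD('d) * (\<integral>z. z $ j * cnj (z $ j) \<partial>\<nu>) = (\<Sum>k\<in>(UNIV :: 'd set). \<integral>z. z $ j * cnj (z $ j) \<partial>\<nu>)"
        by simp
      also have "\<dots> = (\<Sum>k\<in>UNIV. \<integral>z. z $ k * cnj (z $ k) \<partial>\<nu>)"
        by (intro sum.cong refl same)
      also have "\<dots> = (\<integral>z. (\<Sum>k\<in>UNIV. z $ k * cnj (z $ k)) \<partial>\<nu>)"
        by (rule Bochner_Integration.integral_sum[symmetric])
           (intro integrable continuous_intros)
      also have "\<dots> = (\<integral>z. 1 \<partial>\<nu>)"
        by (intro Bochner_Integration.integral_cong refl sum_coord_mult_cnj_eq_1[OF sets])
      finally show ?thesis by (simp add: nonzero_eq_divide_eq mult.commute prob_space)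
    qed
    show "isotropic \<nu>"
      unfolding isotropic_def using first off_diagonal diagonal by auto
  next
    assume iso: "isotropic \<nu>"
    show "\<forall>g\<in>mean_zero_polys 1 1. integral\<^sup>L \<nu> g = 0"
    proof
      fix g :: "complex ^ 'd \<Rightarrow> complex" assume "g \<in> mean_zero_polys 1 1"
      then obtain w w' where w: "w \<le> 1" "w' \<le> 1" "g \<in> bihom_polys w w'" and mean: "integral\<^sup>L ?S g = 0"
        by (auto simp: mean_zero_polys_def bihom_polys_upto_def)
      obtain cs where cs: "\<And>c l. (c, l) \<in> set cs \<Longrightarrow> holo_degree l = w \<and> antiholo_degree l = w'"
        and g: "g = (\<lambda>z. \<Sum>(c, l)\<leftarrow>cs. c * word_monomial l z)"
        using bihom_polys_words[OF w(3)] by blast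
      have "integral\<^sup>L ?S g = (\<Sum>(c, l)\<leftarrow>cs. c * (\<integral>z. word_monomial l z \<partial>?S))"
        unfolding g by (rule integral_word_sum[OF finite_measure_sphere_volume sets_sphere_volume])
      also have "\<dots> = (\<Sum>(c, l)\<leftarrow>cs. of_real (measure ?S (space ?S)) * (c * (\<integral>z. word_monomial l z \<partial>\<nu>)))"
      proof (intro arg_cong[where f = sum_list] map_cong refl)
        fix i assume "i \<in> set cs"
        then have "holo_degree (snd i) \<le> 1" "antiholo_degree (snd i) \<le> 1"
          using cs[of "fst i" "snd i"] w by auto
        from isotropic_integral_word_monomial[OF assms(1) iso this]
        show "(case i of (c, l) \<Rightarrow> c * (\<integral>z. word_monomial l z \<partial>?S)) =
           (case i of (c, l) \<Rightarrow> of_real (measure ?S (space ?S)) * (c * (\<integral>z. word_monomial l z \<partial>\<nu>)))"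
          by (simp add: case_prod_unfold)
      qed
      also have "\<dots> = of_real (measure ?S (space ?S)) * integral\<^sup>L \<nu> g"
        unfolding g integral_word_sum[OF finite_measure_axioms sets]
        by (simp add: case_prod_unfold sum_list_const_mult)
      finally show "integral\<^sup>L \<nu> g = 0"
        using mean measure_sphere_volume_pos[where 'd = 'd] by simp
    qed
  }
qed

section \<open>Atoms of isotropic measures\<close>

definition herm :: "complex ^ 'd::finite \<Rightarrow> complex ^ 'd \<Rightarrow> complex" where
  "herm z x = (\<Sum>j\<in>UNIV. z $ j * cnj (x $ j))"

lemma Re_herm: "Re (herm z x) = z \<bullet> x"
  by (simp add: herm_def inner_vec_def inner_complex_def)

lemma herm_same: "herm x x = of_real ((norm x)\<^sup>2)"
  unfolding herm_def complex_norm_square[symmetric] of_real_sum[symmetric]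
  by (simp add: norm_vec_def L2_set_def sum_nonneg)

lemma continuous_on_herm: "continuous_on UNIV (\<lambda>z. herm z x)"
  unfolding herm_def by (intro continuous_intros)

text \<open>
  The test function is $|\langle v_z, v_x\rangle|^2$ for $v_z = (1, \sqrt N z)$ with $N$ the
  dimension. Its integral depends only on the moments in the definition of isotropy; it equals
  $\langle v_x, v_x\rangle = 1 + N$ because the average of $v_z v_z^*$ is the identity.
\<close>

lemma integral_test_function:
  fixes \<nu> :: "(complex ^ 'd::finite) measure"
  assumes "prob_space \<nu>" and sets: "sets \<nu> = sets csphere" and "isotropic \<nu>" and "norm x = 1"
  shows "(\<integral>z. (norm (1 + of_nat CARD('d) * herm z x))\<^sup>2 \<partial>\<nu>) = of_nat CARD('d) + 1"
proof -
  interpret prob_space \<nu> by fact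
  let ?N = "of_nat CARD('d) :: complex"
  note integrable = integrable_continuous_csphere[OF finite_measure_axioms sets]
  have int1: "integrable \<nu> (\<lambda>z. herm z x)"
    and int2: "integrable \<nu> (\<lambda>z. cnj (herm z x))"
    and int3: "integrable \<nu> (\<lambda>z. herm z x * cnj (herm z x))"
    by (intro integrable continuous_intros continuous_on_herm)+
  have mean: "(\<integral>z. herm z x \<partial>\<nu>) = 0"
    using assms(3) unfolding herm_def isotropic_def
    by (subst Bochner_Integration.integral_sum)
       (auto intro!: integrable continuous_intros)
  have term_integrable: "integrable \<nu> (\<lambda>z. z $ j * cnj (z $ k) * c)" for j k c
    by (intro integrable continuous_intros)
  have "(\<integral>z. herm z x * cnj (herm z x) \<partial>\<nu>) =
    (\<integral>z. (\<Sum>j\<in>UNIV. \<Sum>k\<in>UNIV. (z $ j * cnj (z $ k)) * (cnj (x $ j) * x $ k)) \<partial>\<nu>)"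
    by (simp add: herm_def sum_product mult_ac)
  also have "\<dots> = (\<Sum>j\<in>UNIV. \<Sum>k\<in>UNIV. (\<integral>z. z $ j * cnj (z $ k) \<partial>\<nu>) * (cnj (x $ j) * x $ k))"
    by (simp add: Bochner_Integration.integral_sum Bochner_Integration.integrable_sum term_integrable)
  also have "\<dots> = (\<Sum>j\<in>UNIV. \<Sum>k\<in>UNIV. if j = k then 1 / ?N * (cnj (x $ j) * x $ k) else 0)"
    using assms(3) by (intro sum.cong refl) (simp add: isotropic_def)
  also have "\<dots> = 1 / ?N * herm x x"
    by (simp add: herm_def sum_distrib_left mult_ac)
  finally have second: "(\<integral>z. herm z x * cnj (herm z x) \<partial>\<nu>) = 1 / ?N"
    by (simp add: herm_same assms(4))
  have "complex_of_real (\<integral>z. (norm (1 + ?N * herm z x))\<^sup>2 \<partial>\<nu>) =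
      (\<integral>z. (1 + ?N * herm z x) * cnj (1 + ?N * herm z x) \<partial>\<nu>)"
    unfolding integral_complex_of_real[symmetric] complex_norm_square ..
  also have "\<dots> = (\<integral>z. 1 + ?N * herm z x + ?N * cnj (herm z x) + ?N\<^sup>2 * (herm z x * cnj (herm z x)) \<partial>\<nu>)"
    by (intro Bochner_Integration.integral_cong refl) (simp add: algebra_simps power2_eq_square)
  also have "\<dots> = 1 + ?N\<^sup>2 * (1 / ?N)"
    by (simp add: int1 int2 int3 mean second prob_space)
  also have "\<dots> = of_real (of_nat CARD('d) + 1)"
    by (simp add: power2_eq_square)
  finally show ?thesis
    unfolding of_real_eq_iff .
qed

lemma (in finite_measure) sum_atoms_le_integral:
  fixes h :: "'a \<Rightarrow> real"
  assumes "finite F" and "\<And>y. y \<in> F \<Longrightarrow> {y} \<in> sets M" and h: "integrable M h" and "\<And>z. h z \<ge> 0"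
  shows "(\<Sum>y\<in>F. measure M {y} * h y) \<le> integral\<^sup>L M h"
proof -
  have "(\<Sum>y\<in>F. measure M {y} * h y) = (\<integral>z. (\<Sum>y\<in>F. indicator {y} z * h y) \<partial>M)"
    using assms by (subst Bochner_Integration.integral_sum) (auto simp: integrable_mult_left_iff less_top[symmetric])
  also have "\<dots> \<le> integral\<^sup>L M h"
  proof (intro integral_mono h Bochner_Integration.integrable_sum)
    show "integrable M (\<lambda>z. indicator {y} z * h y)" if "y \<in> F" for y
      using assms that by (auto simp: less_top[symmetric])
    show "(\<Sum>y\<in>F. indicator {y} z * h y) \<le> h z" for z
    proof -
      have "(\<Sum>y\<in>F. indicator {y} z * h y) = (\<Sum>y\<in>F. if y = z then h y else 0)"
        by (intro sum.cong) (auto simp: indicator_def)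
      then show ?thesis using assms by simp
    qed
  qed
  finally show ?thesis .
qed

text \<open>
  The test function at \<open>x\<close> has the value $(N + 1)^2$ in \<open>x\<close> and the integral $N + 1$, so an atom
  in \<open>x\<close> has mass at most $1 / (N + 1)$. If it has this mass, then it exhausts the
  integral, and the test function has to vanish at all other atoms.
\<close>

lemma isotropic_atom_le:
  fixes \<nu> :: "(complex ^ 'd::finite) measure"
  assumes "prob_space \<nu>" and sets: "sets \<nu> = sets csphere" and "isotropic \<nu>" and "norm x = 1"
  shows "measure \<nu> {x} \<le> 1 / (of_nat CARD('d) + 1)"
    and "measure \<nu> {x} = 1 / (of_nat CARD('d) + 1) \<Longrightarrow> norm y = 1 \<Longrightarrow> y \<noteq> x \<Longrightarrow>
      measure \<nu> {y} > 0 \<Longrightarrow> herm y x = - 1 / of_nat CARD('d)"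
proof -
  interpret prob_space \<nu> by fact
  let ?N = "real CARD('d)"
  define h where "h z = (norm (1 + of_nat CARD('d) * herm z x))\<^sup>2" for z
  have cont: "continuous_on UNIV h"
    unfolding h_def by (intro continuous_intros continuous_on_herm)
  have hx: "h x = (?N + 1)\<^sup>2"
  proof -
    have "1 + of_nat CARD('d) * herm x x = complex_of_real (?N + 1)"
      by (simp add: herm_same assms(4))
    then show ?thesis unfolding h_def by (simp only: norm_of_real power2_abs)
  qed
  have nonneg: "0 \<le> h z" for z
    by (simp add: h_def)
  have le: "(\<Sum>y\<in>F. measure \<nu> {y} * h y) \<le> ?N + 1" if "finite F" "F \<subseteq> sphere 0 1" for F
    using sum_atoms_le_integral[OF that(1) singleton_in_sets[OF sets] integrable_continuous_csphere[OF finite_measure_axioms sets cont]]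
      integral_test_function[OF assms, folded h_def] that(2) nonneg by (auto simp: subset_iff)
  have "measure \<nu> {x} * (?N + 1) * (?N + 1) \<le> 1 * (?N + 1)"
    using le[of "{x}"] assms(4) by (simp add: hx power2_eq_square mult.assoc)
  then have "measure \<nu> {x} * (?N + 1) \<le> 1"
    by (rule mult_right_le_imp_le) simp
  then show "measure \<nu> {x} \<le> 1 / (?N + 1)"
    by (simp add: field_simps)
  assume x: "measure \<nu> {x} = 1 / (?N + 1)" and y: "norm y = 1" "y \<noteq> x" "measure \<nu> {y} > 0"
  have "measure \<nu> {x} * h x = ?N + 1"
    unfolding x hx by (simp add: power2_eq_square)
  then have "measure \<nu> {y} * h y \<le> 0"
    using le[of "{x, y}"] assms(4) y by simp
  then have "h y \<le> 0"
    using y(3) by (simp add: mult_le_0_iff)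
  then have "1 + of_nat CARD('d) * herm y x = 0"
    by (simp add: h_def)
  then have "herm y x * of_nat CARD('d) = - 1"
    by (simp add: eq_neg_iff_add_eq_0 mult.commute add.commute)
  then show "herm y x = - 1 / of_nat CARD('d)"
    by (subst nonzero_eq_divide_eq) simp_all
qed

text \<open>
  Affine independence: if $\sum_w u_w w = 0$ and $\sum_w u_w = 0$, then the inner product with a
  vertex \<open>v\<close> gives $u_v (1 + 1/m) = 0$.
\<close>

lemma regular_simplex_verticesI:
  fixes V :: "'a::euclidean_space set"
  assumes "card V = m + 1" and "m > 0" and unit: "\<And>v. v \<in> V \<Longrightarrow> norm v = 1"
    and inner: "\<And>v w. v \<in> V \<Longrightarrow> w \<in> V \<Longrightarrow> v \<noteq> w \<Longrightarrow> v \<bullet> w = - 1 / real m"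
  shows "regular_simplex_vertices m V"
proof -
  have "finite V" using assms(1) card.infinite by fastforce
  have "\<not> affine_dependent V"
  proof
    assume "affine_dependent V"
    then obtain u v where u: "sum u V = 0" "v \<in> V" "u v \<noteq> 0" "(\<Sum>w\<in>V. u w *\<^sub>R w) = 0"
      using affine_dependent_explicit_finite[OF \<open>finite V\<close>] by blast
    have "0 = (\<Sum>w\<in>V. u w *\<^sub>R w) \<bullet> v"
      by (simp add: u)
    also have "\<dots> = (\<Sum>w\<in>V. u w * (w \<bullet> v))"
      by (simp add: inner_sum_left)
    also have "\<dots> = (\<Sum>w\<in>V. u w * (- 1 / real m) + (if w = v then u w * (1 + 1 / real m) else 0))"
      using unit inner u(2) by (intro sum.cong refl) (auto simp: dot_square_norm algebra_simps)
    also have "\<dots> = sum u V * (- 1 / real m) + u v * (1 + 1 / real m)"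
      unfolding sum.distrib sum_distrib_right using u(2) \<open>finite V\<close> by simp
    finally have "u v * (1 + 1 / real m) = 0" by (simp add: u)
    moreover have "1 + 1 / real m \<noteq> 0" using assms(2) by (simp add: field_simps)
    ultimately show False using u(3) by simp
  qed
  moreover have "pairwise (\<lambda>v w. dist v w = sqrt (2 + 2 / real m)) V"
  proof (rule pairwiseI)
    fix v w assume vw: "v \<in> V" "w \<in> V" "v \<noteq> w"
    have "v \<bullet> v = 1" "w \<bullet> w = 1" "v \<bullet> w = - 1 / real m" "w \<bullet> v = - 1 / real m"
      using vw unit inner by (auto simp flip: norm_eq_1)
    then have "(dist v w)\<^sup>2 = 2 + 2 / real m"
      unfolding dist_norm power2_norm_eq_inner inner_diff_left inner_diff_right by simp
    then show "dist v w = sqrt (2 + 2 / real m)"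
      by (simp add: real_sqrt_unique)
  qed
  ultimately show ?thesis
    using assms(1) unfolding regular_simplex_vertices_def by blast
qed

section \<open>Sums of powers of the atoms\<close>

text \<open>
  The carrying set \<open>A\<close> differs from the set of atoms by countably many points of mass zero, hence
  by a null set.
\<close>

lemma prob_space_atoms:
  assumes "prob_space \<nu>" and single: "\<And>x. x \<in> space \<nu> \<Longrightarrow> {x} \<in> sets \<nu>"
    and "\<exists>A. countable A \<and> (AE x in \<nu>. x \<in> A)"
  shows AE_atoms: "AE x in \<nu>. x \<in> atoms \<nu>"
    and has_sum_atoms: "((\<lambda>x. measure \<nu> {x}) has_sum 1) (atoms \<nu>)"
proof -
  interpret prob_space \<nu> by fact
  have "atoms \<nu> \<subseteq> {x. measure \<nu> {x} \<noteq> 0}" by (auto simp: atoms_def)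
  then have count: "countable (atoms \<nu>)"
    using countable_support countable_subset by blast
  obtain A where A: "countable A" "AE x in \<nu>. x \<in> A" using assms(3) by blast
  have "AE x in \<nu>. x \<noteq> y" if "y \<in> (A \<inter> space \<nu>) - atoms \<nu>" for y
  proof -
    have "{y} \<in> null_sets \<nu>"
      using that single[of y] by (auto simp: atoms_def emeasure_eq_measure zero_less_measure_iff not_less measure_le_0_iff)
    from AE_not_in[OF this] show ?thesis by simp
  qed
  then have "AE x in \<nu>. \<forall>y \<in> (A \<inter> space \<nu>) - atoms \<nu>. x \<noteq> y"
    using A(1) by (subst AE_ball_countable) auto
  with A(2) AE_space show ae: "AE x in \<nu>. x \<in> atoms \<nu>"
    by eventually_elim blast
  have sets: "atoms \<nu> \<in> sets \<nu>"
    by (rule sets.countable[OF _ count]) (auto simp: atoms_def single)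
  have "emeasure \<nu> (atoms \<nu>) = 1"
    using emeasure_eq_1_AE[OF sets ae] .
  then have nn: "(\<integral>\<^sup>+x. ennreal (measure \<nu> {x}) \<partial>count_space (atoms \<nu>)) = 1"
    using emeasure_countable_singleton[OF _ count, of \<nu>] by (auto simp: atoms_def single emeasure_eq_measure)
  have int: "integrable (count_space (atoms \<nu>)) (\<lambda>x. measure \<nu> {x})"
    by (rule integrableI_nonneg) (auto simp: nn)
  then have summable: "Infinite_Set_Sum.abs_summable_on (\<lambda>x. measure \<nu> {x}) (atoms \<nu>)"
    by (simp add: abs_summable_on_def)
  have "infsetsum (\<lambda>x. measure \<nu> {x}) (atoms \<nu>) = 1"
    by (simp add: infsetsum_def integral_eq_nn_integral nn)
  then have "infsum (\<lambda>x. measure \<nu> {x}) (atoms \<nu>) = 1"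
    using infsetsum_infsum[OF summable] by simp
  moreover have "(\<lambda>x. measure \<nu> {x}) summable_on atoms \<nu>"
    using summable abs_summable_equivalent abs_summable_summable by blast
  ultimately show "((\<lambda>x. measure \<nu> {x}) has_sum 1) (atoms \<nu>)"
    using has_sum_infsum by metis
qed

lemma infsum_ennreal_eq:
  assumes "(f has_sum s) A" and "\<And>x. x \<in> A \<Longrightarrow> 0 \<le> f x"
  shows "(\<Sum>\<^sub>\<infinity>x\<in>A. ennreal (f x)) = ennreal s"
proof -
  have "ennreal (infsum f A) = (SUP F\<in>{F. finite F \<and> F \<subseteq> A}. ennreal (sum f F))"
    using assms by (intro infsum_nonneg_is_SUPREMUM_ennreal) (auto simp: summable_on_def)
  also have "\<dots> = (SUP F\<in>{F. finite F \<and> F \<subseteq> A}. \<Sum>x\<in>F. ennreal (f x))"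
    using assms(2) by (intro SUP_cong refl sum_ennreal[symmetric]) auto
  also have "\<dots> = (\<Sum>\<^sub>\<infinity>x\<in>A. ennreal (f x))"
    by (rule nonneg_infsum_complete[symmetric]) simp
  finally show ?thesis
    using infsumI[OF assms(1)] by simp
qed

lemma infsum_ennreal_eq_0:
  fixes f :: "'a \<Rightarrow> ennreal"
  assumes "infsum f A = 0" and "x \<in> A"
  shows "f x = 0"
proof -
  have "sum f {x} \<le> infsum f A"
    using assms(2) by (subst nonneg_infsum_complete) (auto intro!: SUP_upper2[of "{x}"])
  then show ?thesis using assms(1) by simp
qed

text \<open>
  Both parts come from $p^\theta = (1/p)^{1-\theta}\, p$ and $1/p \ge M$, since
  $t \mapsto t^{1-\theta}$ is strictly increasing.
\<close>

lemma powr_minus_linear: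
  fixes p M \<theta> :: real
  assumes "0 < p" and "p \<le> 1 / M" and "0 < M" and "\<theta> < 1"
  shows "M powr (1 - \<theta>) * p \<le> p powr \<theta>"
    and "p powr \<theta> = M powr (1 - \<theta>) * p \<longleftrightarrow> p = 1 / M"
proof -
  have p: "p powr \<theta> = (1 / p) powr (1 - \<theta>) * p"
    using assms(1) powr_mult_base[of p "\<theta> - 1"]
    by (simp add: powr_divide powr_minus_divide[of p "1 - \<theta>", symmetric] mult.commute)
  have le: "M \<le> 1 / p" using assms(1,2,3) by (simp add: field_simps)
  show "M powr (1 - \<theta>) * p \<le> p powr \<theta>"
    unfolding p using assms le by (intro mult_right_mono powr_mono2) auto
  show "p powr \<theta> = M powr (1 - \<theta>) * p \<longleftrightarrow> p = 1 / M"
  proof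
    assume "p powr \<theta> = M powr (1 - \<theta>) * p"
    then have "(1 / p) powr (1 - \<theta>) = M powr (1 - \<theta>)"
      unfolding p using assms(1) by simp
    then have "\<not> M < 1 / p"
      using powr_less_mono2[of "1 - \<theta>" M "1 / p"] assms by auto
    then show "p = 1 / M" using le assms by (simp add: field_simps)
  next
    assume "p = 1 / M"
    then have "1 / p = M" by simp
    then show "p powr \<theta> = M powr (1 - \<theta>) * p" by (subst p) simp
  qed
qed

text \<open>
  Each term exceeds its linear lower bound by a nonnegative amount, and the linear lower bounds have
  the finite sum $M^{1-\theta}$. So the total equals $M^{1-\theta}$ plus the sum \<open>?D\<close> of the
  excesses in the extended nonnegative reals, and equality means that all excesses vanish. This
  covers divergent sums as well.
\<close>

lemma infsum_powr_ge:
  fixes p :: "'a \<Rightarrow> real"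
  assumes p: "(p has_sum 1) A" and bounds: "\<And>x. x \<in> A \<Longrightarrow> 0 < p x \<and> p x \<le> 1 / M"
    and "0 < M" and "\<theta> < 1"
  shows "ennreal (M powr (1 - \<theta>)) \<le> (\<Sum>\<^sub>\<infinity>x\<in>A. ennreal (p x powr \<theta>))"
    and "(\<Sum>\<^sub>\<infinity>x\<in>A. ennreal (p x powr \<theta>)) = ennreal (M powr (1 - \<theta>)) \<longleftrightarrow> (\<forall>x\<in>A. p x = 1 / M)"
proof -
  let ?C = "M powr (1 - \<theta>)"
  let ?D = "\<Sum>\<^sub>\<infinity>x\<in>A. ennreal (p x powr \<theta> - ?C * p x)"
  have gap: "0 \<le> p x powr \<theta> - ?C * p x" and gap0: "p x powr \<theta> - ?C * p x = 0 \<longleftrightarrow> p x = 1 / M" if "x \<in> A" for x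
    using powr_minus_linear[of "p x" M \<theta>] bounds[OF that] assms(3,4) by auto
  have "(\<Sum>\<^sub>\<infinity>x\<in>A. ennreal (p x powr \<theta>)) =
      (\<Sum>\<^sub>\<infinity>x\<in>A. ennreal (?C * p x) + ennreal (p x powr \<theta> - ?C * p x))"
    using gap bounds by (intro infsum_cong) (simp add: less_imp_le flip: ennreal_plus)
  also have "\<dots> = (\<Sum>\<^sub>\<infinity>x\<in>A. ennreal (?C * p x)) + ?D"
    by (intro infsum_add nonneg_summable_on_complete) auto
  also have "(\<Sum>\<^sub>\<infinity>x\<in>A. ennreal (?C * p x)) = ennreal ?C"
    using infsum_ennreal_eq[OF has_sum_cmult_right[OF p, of ?C]] bounds by (simp add: less_imp_le)
  finally have sum: "(\<Sum>\<^sub>\<infinity>x\<in>A. ennreal (p x powr \<theta>)) = ennreal ?C + ?D" .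
  show "ennreal ?C \<le> (\<Sum>\<^sub>\<infinity>x\<in>A. ennreal (p x powr \<theta>))"
    unfolding sum by simp
  have "(\<Sum>\<^sub>\<infinity>x\<in>A. ennreal (p x powr \<theta>)) = ennreal ?C \<longleftrightarrow> ?D = 0"
    unfolding sum using ennreal_add_left_cancel[of "ennreal ?C" ?D 0] by simp
  also have "\<dots> \<longleftrightarrow> (\<forall>x\<in>A. ennreal (p x powr \<theta> - ?C * p x) = 0)"
    using infsum_ennreal_eq_0 by (auto intro!: infsum_0)
  also have "\<dots> \<longleftrightarrow> (\<forall>x\<in>A. p x = 1 / M)"
    using gap gap0 by (intro ball_cong refl) (metis ennreal_eq_0_iff order_antisym order_refl)
  finally show "(\<Sum>\<^sub>\<infinity>x\<in>A. ennreal (p x powr \<theta>)) = ennreal ?C \<longleftrightarrow> (\<forall>x\<in>A. p x = 1 / M)" .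
qed

section \<open>The lower bound and a measure that attains it\<close>

lemma Mc_1_1_iff:
  "\<nu> \<in> Mc 1 1 \<longleftrightarrow> sets \<nu> = sets csphere \<and> prob_space \<nu> \<and>
     (\<exists>A. countable A \<and> (AE x in \<nu>. x \<in> A)) \<and> isotropic \<nu>"
  unfolding Mc_def using vanishing_on_mean_zero_polys_iff_isotropic by blast

lemma theta_sum_ge:
  fixes \<nu> :: "(complex ^ 'd::finite) measure"
  assumes "\<nu> \<in> Mc 1 1" and "\<theta> < 1"
  defines "M \<equiv> real CARD('d) + 1"
  shows "ennreal (M powr (1 - \<theta>)) \<le> theta_sum \<theta> \<nu>"
    and "theta_sum \<theta> \<nu> = ennreal (M powr (1 - \<theta>)) \<longleftrightarrow> (\<forall>x\<in>atoms \<nu>. measure \<nu> {x} = 1 / M)"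
proof -
  have \<nu>: "sets \<nu> = sets csphere" "prob_space \<nu>" "\<exists>A. countable A \<and> (AE x in \<nu>. x \<in> A)" "isotropic \<nu>"
    using assms(1) unfolding Mc_1_1_iff by auto
  have sum: "((\<lambda>x. measure \<nu> {x}) has_sum 1) (atoms \<nu>)"
    using \<nu> by (intro has_sum_atoms) (auto simp: space_eq_sphere singleton_in_sets)
  have bounds: "0 < measure \<nu> {x} \<and> measure \<nu> {x} \<le> 1 / M" if "x \<in> atoms \<nu>" for x
    using that isotropic_atom_le(1)[OF \<nu>(2,1,4), of x]
    by (simp add: atoms_def M_def space_eq_sphere[OF \<nu>(1)])
  have "0 < M" by (simp add: M_def)
  note infsum_powr_ge[OF sum bounds this assms(2)]
  then show "ennreal (M powr (1 - \<theta>)) \<le> theta_sum \<theta> \<nu>"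
    "theta_sum \<theta> \<nu> = ennreal (M powr (1 - \<theta>)) \<longleftrightarrow> (\<forall>x\<in>atoms \<nu>. measure \<nu> {x} = 1 / M)"
    unfolding theta_sum_def by auto
qed

text \<open>
  Since atoms never have mass above \<open>1 / (CARD('d) + 1)\<close>, a lower bound on them is
  enough for equality. A uniform measure on \<open>CARD('d) + 1\<close> listed points satisfies it, as
  every atom is listed at least once.
\<close>

lemma theta_sum_eq_if_atoms_ge:
  fixes \<nu> :: "(complex ^ 'd::finite) measure"
  assumes "\<nu> \<in> Mc 1 1" and "\<theta> < 1"
    and "\<And>x. x \<in> atoms \<nu> \<Longrightarrow> measure \<nu> {x} \<ge> 1 / (real CARD('d) + 1)"
  shows "theta_sum \<theta> \<nu> = ennreal ((real CARD('d) + 1) powr (1 - \<theta>))"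
proof -
  have \<nu>: "sets \<nu> = sets csphere" "prob_space \<nu>" "isotropic \<nu>"
    using assms(1) unfolding Mc_1_1_iff by auto
  have "measure \<nu> {x} = 1 / (real CARD('d) + 1)" if "x \<in> atoms \<nu>" for x
    using that isotropic_atom_le(1)[OF \<nu>(2,1,3), of x] assms(3)[OF that]
    by (simp add: atoms_def space_eq_sphere[OF \<nu>(1)])
  then show ?thesis
    using theta_sum_ge(2)[OF assms(1,2)] by blast
qed

lemma sum_powers_root_of_unity:
  fixes w :: complex
  assumes "w ^ m = 1"
  shows "(\<Sum>k<m. w ^ k) = (if w = 1 then of_nat m else 0)"
  using assms by (auto simp: geometric_sum)

text \<open>
  Deleting the constant row from the character table of the cyclic group of order $m = N + 1$
  leaves \<open>m\<close> columns in $\mathbb{C}^N$, which form a regular simplex after rescaling. The rows that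
  remain belong to the nontrivial \<open>m\<close>-th roots of unity; their powers sum to zero, which gives the first
  moments, and the quotient of two different ones is again a nontrivial root, which gives the
  second moments.
\<close>

lemma exists_measure_with_large_atoms:
  "\<exists>\<nu> \<in> Mc 1 1 :: (complex ^ 'd::finite) measure set.
     \<forall>x\<in>atoms \<nu>. measure \<nu> {x} \<ge> 1 / (real CARD('d) + 1)"
proof -
  let ?N = "CARD('d)"
  define m where "m = ?N + 1"
  have "m > 0" by (simp add: m_def)
  define R where "R = {z :: complex. z ^ m = 1} - {1}"
  have "card R = m - 1"
    unfolding R_def using card_roots_unity_eq[OF \<open>m > 0\<close>] by (simp add: card_Diff_singleton)
  then have "card R = ?N" by (simp add: m_def)
  then obtain r where r: "bij_betw r (UNIV :: 'd set) R"
    using finite_same_card_bij[of "UNIV :: 'd set" R] card.infinite by fastforce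
  have root: "r j ^ m = 1" "r j \<noteq> 1" for j
    using bij_betwE[OF r] by (auto simp: R_def)
  have norm: "norm (r j) = 1" for j
    using root(1)[of j] \<open>m > 0\<close> by (metis norm_power norm_one power_eq_1_iff norm_ge_zero less_numeral_extra(3))
  have root_cnj: "r j * cnj (r k) = 1 \<longleftrightarrow> j = k" for j k
  proof
    assume "r j * cnj (r k) = 1"
    then have "r j * (cnj (r k) * r k) = r k" by (simp add: mult.assoc[symmetric])
    then have "r j = r k" by (simp add: norm complex_norm_square[symmetric] mult.commute[of "cnj _"])
    then show "j = k" using r by (auto simp: bij_betw_def inj_on_def)
  qed (simp add: norm complex_norm_square[symmetric])
  define x :: "nat \<Rightarrow> complex ^ 'd" where "x k = (\<chi> j. r j ^ k / of_real (sqrt ?N))" for k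
  have unit: "norm (x k) = 1" for k
    by (simp add: x_def norm_vec_def L2_set_def norm_divide norm_power norm power_divide)
  then have range: "x k \<in> space csphere" for k
    by (simp add: space_eq_sphere[OF refl])
  define p where "p = pmf_of_set {..<m}"
  define \<nu> where "\<nu> = distr (measure_pmf p) csphere x"
  have sets: "sets \<nu> = sets csphere" by (simp add: \<nu>_def)
  have meas: "x \<in> measure_pmf p \<rightarrow>\<^sub>M csphere" using range by simp
  have prob: "prob_space \<nu>"
    unfolding \<nu>_def using meas by (rule measure_pmf.prob_space_distr)
  have integral: "integral\<^sup>L \<nu> f = (\<Sum>k<m. f (x k)) / of_nat m"
    if "continuous_on UNIV f" for f :: "complex ^ 'd \<Rightarrow> complex"
  proof -
    have "f \<in> borel_measurable csphere"
      unfolding csphere_def using that by (intro measurable_restrict_space1 borel_measurable_continuous_onI)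
    then have "integral\<^sup>L \<nu> f = integral\<^sup>L (measure_pmf p) (\<lambda>k. f (x k))"
      unfolding \<nu>_def by (rule integral_distr[OF meas])
    also have "\<dots> = (\<Sum>k<m. pmf p k *\<^sub>R f (x k))"
      using \<open>m > 0\<close> by (intro integral_measure_pmf) (auto simp: p_def lessThan_empty_iff)
    also have "\<dots> = (\<Sum>k<m. f (x k)) / of_nat m"
      using \<open>m > 0\<close> by (simp add: p_def lessThan_empty_iff sum_divide_distrib scaleR_conv_of_real)
    finally show ?thesis .
  qed
  have "isotropic \<nu>"
    unfolding isotropic_def
  proof (intro conjI allI)
    fix j
    have "(\<Sum>k<m. x k $ j) = (\<Sum>k<m. r j ^ k) / of_real (sqrt ?N)"
      by (simp add: x_def sum_divide_distrib)
    then show "(\<integral>z. z $ j \<partial>\<nu>) = 0"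
      by (subst integral[OF continuous_on_component[OF continuous_on_id]])
        (simp add: sum_powers_root_of_unity root)
  next
    fix j l
    have "of_real (sqrt ?N) * of_real (sqrt ?N) = (of_nat ?N :: complex)"
      by (simp flip: of_real_mult)
    then have "(\<Sum>k<m. x k $ j * cnj (x k $ l)) = (\<Sum>k<m. (r j * cnj (r l)) ^ k) / of_nat ?N"
      by (simp add: x_def sum_divide_distrib power_mult_distrib)
    also have "\<dots> = (if j = l then of_nat m / of_nat ?N else 0)"
      by (subst sum_powers_root_of_unity) (simp_all add: root_cnj power_mult_distrib root flip: complex_cnj_power)
    finally show "(\<integral>z. z $ j * cnj (z $ l) \<partial>\<nu>) = (if j = l then 1 / of_nat ?N else 0)"
      using \<open>m > 0\<close> by (subst integral, intro continuous_intros) simp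
  qed
  moreover have "AE z in \<nu>. z \<in> x ` {..<m}"
  proof -
    have "{z \<in> space csphere. z \<in> x ` {..<m}} = x ` {..<m}"
      using range by auto
    also have "\<dots> \<in> sets csphere"
    proof (rule sets.countable)
      fix y assume "y \<in> x ` {..<m}"
      then show "{y} \<in> sets csphere"
        using unit by (intro singleton_in_sets[OF refl]) auto
    qed simp
    finally show ?thesis
      unfolding \<nu>_def using \<open>m > 0\<close>
      by (subst AE_distr_iff[OF meas]) (auto simp: AE_measure_pmf_iff p_def lessThan_empty_iff)
  qed
  then have "\<exists>A. countable A \<and> (AE z in \<nu>. z \<in> A)"
    by (intro exI[of _ "x ` {..<m}"]) simp
  ultimately have "\<nu> \<in> Mc 1 1"
    unfolding Mc_1_1_iff using sets prob by blast
  moreover have "measure \<nu> {y} \<ge> 1 / (real ?N + 1)" if "y \<in> atoms \<nu>" for y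
  proof -
    have "y \<in> sphere 0 1" "measure \<nu> {y} > 0"
      using that by (auto simp: atoms_def space_eq_sphere[OF sets])
    moreover have "measure \<nu> {y} = real (card ({..<m} \<inter> x -` {y})) / real m"
      using meas singleton_in_sets[OF refl \<open>y \<in> sphere 0 1\<close>] \<open>m > 0\<close>
      by (simp add: \<nu>_def measure_distr p_def measure_pmf_of_set lessThan_empty_iff)
    ultimately have "card ({..<m} \<inter> x -` {y}) \<ge> 1"
      using \<open>m > 0\<close> by (simp add: zero_less_divide_iff)
    then have "1 \<le> real (card ({..<m} \<inter> x -` {y}))" by linarith
    then have "1 / real m \<le> real (card ({..<m} \<inter> x -` {y})) / real m"
      by (rule divide_right_mono) simp
    then show ?thesis
      using \<open>measure \<nu> {y} = _\<close> by (simp add: m_def add.commute)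
  qed
  ultimately show ?thesis by blast
qed

lemma Theta_1_1:
  assumes "\<theta> < 1"
  shows "Theta TYPE('d::finite) 1 1 \<theta> = ennreal ((real CARD('d) + 1) powr (1 - \<theta>))"
proof (rule antisym)
  obtain \<nu> :: "(complex ^ 'd) measure" where "\<nu> \<in> Mc 1 1"
    "\<And>x. x \<in> atoms \<nu> \<Longrightarrow> measure \<nu> {x} \<ge> 1 / (real CARD('d) + 1)"
    using exists_measure_with_large_atoms[where 'd = 'd] by blast
  then show "Theta TYPE('d) 1 1 \<theta> \<le> ennreal ((real CARD('d) + 1) powr (1 - \<theta>))"
    unfolding Theta_def using theta_sum_eq_if_atoms_ge[of \<nu> \<theta>] assms by (intro INF_lower2[of \<nu>]) auto
  show "ennreal ((real CARD('d) + 1) powr (1 - \<theta>)) \<le> Theta TYPE('d) 1 1 \<theta>"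
    unfolding Theta_def by (intro INF_greatest theta_sum_ge(1) assms)
qed

section \<open>Measures with equality\<close>

text \<open>
  Finitely many atoms have total mass at most \<open>1\<close>, so there are at most \<open>M\<close> of them; as all
  mass sits in atoms, there are exactly \<open>M\<close>, and the measure of a set is found by counting atoms.
\<close>

lemma finite_atoms_if_equal_mass:
  fixes \<nu> :: "(complex ^ 'd::finite) measure"
  assumes "\<nu> \<in> Mc 1 1" and "M > 0" and mass: "\<And>x. x \<in> atoms \<nu> \<Longrightarrow> measure \<nu> {x} = 1 / real M"
  shows "finite (atoms \<nu>)" and "card (atoms \<nu>) = M"
    and "A \<in> sets \<nu> \<Longrightarrow> measure \<nu> A = 1 / real M * (\<Sum>y\<in>atoms \<nu>. measure (return csphere y) A)"
proof -
  have \<nu>: "sets \<nu> = sets csphere" "prob_space \<nu>" "\<exists>A. countable A \<and> (AE x in \<nu>. x \<in> A)"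
    using assms(1) unfolding Mc_1_1_iff by auto
  interpret prob_space \<nu> by (rule \<nu>)
  have single: "{x} \<in> sets \<nu>" if "x \<in> space \<nu>" for x
    using that \<nu>(1) by (simp add: space_eq_sphere singleton_in_sets)
  have sum: "((\<lambda>x. measure \<nu> {x}) has_sum 1) (atoms \<nu>)" and ae: "AE x in \<nu>. x \<in> atoms \<nu>"
    using has_sum_atoms[OF \<nu>(2) single \<nu>(3)] AE_atoms[OF \<nu>(2) single \<nu>(3)] by auto
  have "card F \<le> M" if "F \<subseteq> atoms \<nu>" "finite F" for F
  proof -
    have "(\<Sum>x\<in>F. measure \<nu> {x}) \<le> infsum (\<lambda>x. measure \<nu> {x}) (atoms \<nu>)"
      using that sum by (intro finite_sum_le_infsum) (auto simp: summable_on_def)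
    also have "\<dots> = 1" using sum by (rule infsumI)
    also have "(\<Sum>x\<in>F. measure \<nu> {x}) = real (card F) / real M"
      using that mass by (simp add: subset_iff)
    finally show ?thesis using assms(2) by (simp add: field_simps)
  qed
  then show fin: "finite (atoms \<nu>)"
    using finite_if_finite_subsets_card_bdd by blast
  have "(\<Sum>x\<in>atoms \<nu>. measure \<nu> {x}) = 1"
    using sum has_sum_finite_iff[OF fin] by metis
  then show "card (atoms \<nu>) = M"
    using mass assms(2) by simp
  assume A: "A \<in> sets \<nu>"
  have atoms_sub: "atoms \<nu> \<subseteq> space \<nu>" by (auto simp: atoms_def)
  have "measure \<nu> A = measure \<nu> (A \<inter> atoms \<nu>)"
  proof (rule finite_measure_eq_AE)
    show "AE x in \<nu>. x \<in> A \<longleftrightarrow> x \<in> A \<inter> atoms \<nu>" using ae by eventually_elim simp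
    have "A \<inter> atoms \<nu> = (\<Union>x\<in>A \<inter> atoms \<nu>. {x})" by blast
    also have "\<dots> \<in> sets \<nu>"
      using fin single atoms_sub by (intro sets.finite_UN) auto
    finally show "A \<inter> atoms \<nu> \<in> sets \<nu>" .
  qed fact
  also have "\<dots> = (\<Sum>x\<in>A \<inter> atoms \<nu>. measure \<nu> {x})"
    using fin single atoms_sub by (intro finite_measure_eq_sum_singleton) auto
  also have "\<dots> = (\<Sum>x\<in>atoms \<nu>. if x \<in> A then measure \<nu> {x} else 0)"
    by (subst Int_commute) (rule sum.inter_restrict[OF fin])
  also have "\<dots> = (\<Sum>y\<in>atoms \<nu>. 1 / real M * measure (return csphere y) A)"
    using A mass \<nu>(1) by (intro sum.cong refl) (simp add: measure_return)
  finally show "measure \<nu> A = 1 / real M * (\<Sum>y\<in>atoms \<nu>. measure (return csphere y) A)"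
    by (simp add: sum_distrib_left)
qed

theorem proposition3p2:
  fixes n :: nat and \<theta> :: real
  assumes "0 < \<theta>" and "\<theta> < 1" and "CARD('d::finite) = n + 1"
  shows "Theta TYPE('d) 1 1 \<theta> = ennreal (real (n + 2) powr (1 - \<theta>)) \<and>
    (\<forall>\<nu> :: (complex ^ 'd) measure. \<nu> \<in> Mc 1 1 \<longrightarrow>
      (theta_sum \<theta> \<nu> = Theta TYPE('d) 1 1 \<theta> \<longleftrightarrow>
        (\<exists>x :: nat \<Rightarrow> complex ^ 'd.
           x ` {1..n + 2} \<subseteq> sphere 0 1 \<and>
           regular_simplex_vertices (n + 1) (x ` {1..n + 2}) \<and>
           convex hull (x ` {1..n + 2}) \<subseteq> cball 0 1 \<and>
           (\<forall>A\<in>sets \<nu>. measure \<nu> A =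
              1 / real (n + 2) * (\<Sum>i = 1..n + 2. measure (return csphere (x i)) A)))))"
proof -
  have M: "real CARD('d) + 1 = real (n + 2)" using assms(3) by simp
  have Theta: "Theta TYPE('d) 1 1 \<theta> = ennreal (real (n + 2) powr (1 - \<theta>))"
    using Theta_1_1[OF assms(2), where 'd = 'd] unfolding M .
  moreover have "theta_sum \<theta> \<nu> = ennreal (real (n + 2) powr (1 - \<theta>)) \<longleftrightarrow>
        (\<exists>x :: nat \<Rightarrow> complex ^ 'd.
           x ` {1..n + 2} \<subseteq> sphere 0 1 \<and>
           regular_simplex_vertices (n + 1) (x ` {1..n + 2}) \<and>
           convex hull (x ` {1..n + 2}) \<subseteq> cball 0 1 \<and>
           (\<forall>A\<in>sets \<nu>. measure \<nu> A =
              1 / real (n + 2) * (\<Sum>i = 1..n + 2. measure (return csphere (x i)) A)))"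
    if "\<nu> \<in> Mc 1 1" for \<nu> :: "(complex ^ 'd) measure"
  proof
    have \<nu>: "sets \<nu> = sets csphere" "prob_space \<nu>" "isotropic \<nu>"
      using that unfolding Mc_1_1_iff by auto
    {
      assume "theta_sum \<theta> \<nu> = ennreal (real (n + 2) powr (1 - \<theta>))"
      then have mass: "measure \<nu> {x} = 1 / real (n + 2)" if "x \<in> atoms \<nu>" for x
        using theta_sum_ge(2)[OF \<open>\<nu> \<in> Mc 1 1\<close> assms(2)] that unfolding M by blast
      note atoms = finite_atoms_if_equal_mass[OF that _ mass, simplified]
      have sphere: "norm x = 1" "measure \<nu> {x} > 0" if "x \<in> atoms \<nu>" for x
        using that by (auto simp: atoms_def space_eq_sphere[OF \<nu>(1)])
      have inner: "x \<bullet> y = - 1 / real (n + 1)" if "x \<in> atoms \<nu>" "y \<in> atoms \<nu>" "x \<noteq> y" for x y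
      proof -
        have "herm x y = - 1 / of_nat CARD('d)"
          using isotropic_atom_le(2)[OF \<nu>(2,1,3), of y x] mass[OF that(2)] sphere that
          unfolding M by simp
        also have "\<dots> = of_real (- 1 / real (n + 1))"
          by (simp add: assms(3))
        finally show ?thesis
          unfolding Re_herm[symmetric] by (metis Re_complex_of_real)
      qed
      obtain x where x: "bij_betw x {1..n + 2} (atoms \<nu>)"
        using ex_bij_betw_nat_finite_1[OF atoms(1)] atoms(2) by auto
      then have image: "x ` {1..n + 2} = atoms \<nu>" by (simp add: bij_betw_def)
      have "regular_simplex_vertices (n + 1) (atoms \<nu>)"
        using atoms(2) sphere inner by (intro regular_simplex_verticesI) auto
      moreover have "convex hull (atoms \<nu>) \<subseteq> cball 0 1"
        by (rule hull_minimal) (auto simp: sphere)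
      moreover have "measure \<nu> A = 1 / real (n + 2) * (\<Sum>i = 1..n + 2. measure (return csphere (x i)) A)"
        if "A \<in> sets \<nu>" for A
        using atoms(3)[OF that] sum.reindex_bij_betw[OF x, of "\<lambda>y. measure (return csphere y) A"] by simp
      ultimately show "\<exists>x :: nat \<Rightarrow> complex ^ 'd.
           x ` {1..n + 2} \<subseteq> sphere 0 1 \<and>
           regular_simplex_vertices (n + 1) (x ` {1..n + 2}) \<and>
           convex hull (x ` {1..n + 2}) \<subseteq> cball 0 1 \<and>
           (\<forall>A\<in>sets \<nu>. measure \<nu> A =
              1 / real (n + 2) * (\<Sum>i = 1..n + 2. measure (return csphere (x i)) A))"
        using sphere by (intro exI[of _ x]) (unfold image, auto)
    next
      assume "\<exists>x :: nat \<Rightarrow> complex ^ 'd.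
           x ` {1..n + 2} \<subseteq> sphere 0 1 \<and>
           regular_simplex_vertices (n + 1) (x ` {1..n + 2}) \<and>
           convex hull (x ` {1..n + 2}) \<subseteq> cball 0 1 \<and>
           (\<forall>A\<in>sets \<nu>. measure \<nu> A =
              1 / real (n + 2) * (\<Sum>i = 1..n + 2. measure (return csphere (x i)) A))"
      then obtain x :: "nat \<Rightarrow> complex ^ 'd" where
        x: "\<And>A. A \<in> sets \<nu> \<Longrightarrow> measure \<nu> A = 1 / real (n + 2) * (\<Sum>i = 1..n + 2. measure (return csphere (x i)) A)"
        by blast
      have "measure \<nu> {y} \<ge> 1 / (real CARD('d) + 1)" if y: "y \<in> atoms \<nu>" for y
      proof -
        have "{y} \<in> sets \<nu>" "measure \<nu> {y} > 0"
          using y \<nu>(1) by (auto simp: atoms_def space_eq_sphere singleton_in_sets)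
        moreover from this have "measure \<nu> {y} = real (card {i \<in> {1..n + 2}. x i = y}) / real (n + 2)"
          using \<nu>(1) by (simp add: x measure_return indicator_def sum.If_cases Int_def del: of_nat_add sum.cl_ivl_Suc)
        ultimately have "card {i \<in> {1..n + 2}. x i = y} \<ge> 1"
          by (simp add: zero_less_divide_iff)
        then have "1 \<le> real (card {i \<in> {1..n + 2}. x i = y})" by linarith
        then show ?thesis
          unfolding M \<open>measure \<nu> {y} = _\<close> by (rule divide_right_mono) simp
      qed
      from theta_sum_eq_if_atoms_ge[OF that assms(2) this]
      show "theta_sum \<theta> \<nu> = ennreal (real (n + 2) powr (1 - \<theta>))"
        unfolding M by blast
    }
  qed
  ultimately show ?thesis by simp
qed

end
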